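(* Let $\alpha$ be an infinite word over the alphabet $\mathbb N$. If there are two distinct letters $i,j$ that alternate more than four times in $\alpha$ (that is, $\alpha$ contains more than four $(i,j)$-alternances), then the path-star graph class $\mathcal R^{\alpha}$ is not a subclass of the class of circle graphs; that is, some graph in $\mathcal R^{\alpha}$ is not a circle graph.
   Context: $\mathbb N=\{1,2,3,\dots\}$, and $\alpha_j$ denotes the $j$-th letter of $\alpha$. A factor of $\alpha$ is a contiguous subword. For distinct letters $i,j$, an $(i,j)$-alternance in $\alpha$ is a factor (occurring at a specific position) that starts with one of the letters $i,j$ and ends with the other, with no other occurrence of either letter $i$ or $j$ in the factor. (For example, the word $11212221112$ alternates $5$ times between $1$ and $2$.) The infinite path-star graph $R^{\alpha}=(V_P\cup V_S,\;E_P\cup E_S)$ has path-vertices $V_P=\{p_j: j\in\mathbb N\}$, star-vertices $V_S=\{s_i: i\in\mathbb N\}$, path edges $E_P=\{p_jp_{j+1}: j\in\mathbb N\}$ and star edges $E_S=\{p_js_{\alpha_j}: j\in\mathbb N\}$. The path-star class $\mathcal R^{\alpha}$ is the class of all finite induced subgraphs of $R^{\alpha}$ (up to isomorphism). A circle graph is the intersection graph of finitely many chords of a circle. *)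

theory Defs
  imports
    "HOL-Analysis.Analysis"
    "Graph_Theory.Pair_Digraph"
    "Graph_Theory.Digraph_Isomorphism"
begin

text \<open>
  Simple graphs are rendered as in Graph_Theory: loopfree symmetric digraphs, here of type
  \<^typ>\<open>'v pair_pre_digraph\<close>, where an undirected edge \<open>uv\<close> is the pair of arcs
  \<open>(u, v)\<close> and \<open>(v, u)\<close>.
\<close>

text \<open>
  Positions and letters are numbered from 1. A word is a function on \<^typ>\<open>nat\<close> whose value
  at 0 is irrelevant.
\<close>

definition infinite_word :: "(nat \<Rightarrow> nat) \<Rightarrow> bool" where
  "infinite_word \<alpha> \<longleftrightarrow> (\<forall>n\<ge>1. \<alpha> n \<ge> 1)"

text \<open>
  An alternance is identified with the pair of positions of its first and last letter.
\<close>

definition alternances :: "(nat \<Rightarrow> nat) \<Rightarrow> nat \<Rightarrow> nat \<Rightarrow> (nat \<times> nat) set" where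
  "alternances \<alpha> i j =
     {(a, b). 1 \<le> a \<and> a \<le> b \<and>
        (\<alpha> a = i \<and> \<alpha> b = j \<or> \<alpha> a = j \<and> \<alpha> b = i) \<and>
        (\<forall>k. a < k \<and> k < b \<longrightarrow> \<alpha> k \<noteq> i \<and> \<alpha> k \<noteq> j)}"

datatype ps_vertex = Path_vertex nat | Star_vertex nat

definition path_star_edges :: "(nat \<Rightarrow> nat) \<Rightarrow> ps_vertex rel" where
  "path_star_edges \<alpha> =
     {(Path_vertex j, Path_vertex (j + 1)) | j. j \<ge> 1} \<union>
     {(Path_vertex j, Star_vertex (\<alpha> j)) | j. j \<ge> 1}"

definition path_star_graph :: "(nat \<Rightarrow> nat) \<Rightarrow> ps_vertex pair_pre_digraph" where
  "path_star_graph \<alpha> =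
     \<lparr> pverts = Path_vertex ` {1..} \<union> Star_vertex ` {1..},
       parcs = path_star_edges \<alpha> \<union> (path_star_edges \<alpha>)\<inverse> \<rparr>"

text \<open>
  Classes of finite graphs up to isomorphism are isomorphism-closed sets of graphs with vertices
  in a type \<^typ>\<open>'v\<close>. If \<^typ>\<open>'v\<close> is infinite, every finite graph has an isomorphic copy
  of this type.
\<close>

definition path_star_class :: "(nat \<Rightarrow> nat) \<Rightarrow> 'v pair_pre_digraph set" where
  "path_star_class \<alpha> =
     {G. \<exists>H :: ps_vertex pair_pre_digraph.
           finite (pverts H) \<and>
           induced_subgraph (with_proj H) (with_proj (path_star_graph \<alpha>)) \<and>
           digraph_iso (with_proj H) (with_proj G)}"

definition intersection_graph :: "'v set \<Rightarrow> ('v \<Rightarrow> 'p set) \<Rightarrow> 'v pair_pre_digraph" where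
  "intersection_graph V c =
     \<lparr> pverts = V,
       parcs = {(u, v). u \<in> V \<and> v \<in> V \<and> u \<noteq> v \<and> c u \<inter> c v \<noteq> {}} \<rparr>"

definition chords :: "complex \<Rightarrow> real \<Rightarrow> complex set set" where
  "chords z r = {closed_segment a b | a b. a \<in> sphere z r \<and> b \<in> sphere z r \<and> a \<noteq> b}"

definition circle_graphs :: "'v pair_pre_digraph set" where
  "circle_graphs =
     {intersection_graph V c | V c.
        finite V \<and> (\<exists>z r. r > 0 \<and> (\<forall>v\<in>V. c v \<in> chords z r))}"

end

theory Submission
  imports Defs
begin

text \<open>
  Measure the points of a circle by an angle, so that a chord becomes a pair of reals. Disjoint
  chords are then pairs that do not interleave. The one principle behind the proof is
  \<open>unlinked_Un\<close>: if \<open>X\<close> and \<open>Y\<close> interleave and neither interleaves with \<open>Z\<close>, then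
  \<open>X \<union> Y\<close> does not interleave with \<open>Z\<close>. By induction, a chain of consecutively crossing
  chords (a \<^emph>\<open>strand\<close>) behaves like a single chord: two strands without a common point have
  non-interleaving sets of endpoints.

  Take five alternances and suppose that the subgraph induced by the two stars \<open>i\<close>, \<open>j\<close> and the
  path vertices from the first to the fifth of them has a chord model. The disjoint star chords cut off two caps, and two
  gaps of the circle remain, one on either side between the caps. The strand \<open>X\<close> of an
  alternance has an endpoint in each cap, and each of its chords has an endpoint in a gap. Two
  facts about such a strand \<open>X\<close> and a strand \<open>Y\<close> disjoint from it follow from non-interleaving:
  \<open>Y\<close> cannot have endpoints in both gaps, since the two cap points of \<open>X\<close> separate the gaps;
  and if \<open>Y\<close> is the strand of an alternance too, then \<open>X\<close> and \<open>Y\<close> do not have endpoints in the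
  same gap, since three points of \<open>X\<close> in one cap, the gap and the other cap would interleave with
  three such points of \<open>Y\<close>.

  Let \<open>[a, b]\<close>, \<open>[a', b']\<close>, \<open>[a'', b'']\<close> be the first, third and fifth alternance. The strands
  of the first and the fifth are disjoint, hence use different gaps. A path chord \<open>k\<close> with
  \<open>b + 2 \<le> k\<close> lies on a strand that avoids the first and contains the last, so its gap endpoints
  lie in the gap of the fifth alternance; symmetrically, if \<open>k + 2 \<le> a''\<close>, they lie in the gap
  of the first. No chord of the third alternance may satisfy both conditions, and this forces
  \<open>a' = b + 1\<close>, \<open>b' = a' + 1\<close> and \<open>a'' = b' + 1\<close>. The consecutive chords \<open>a'\<close> and \<open>b'\<close>
  then run from different caps to different gaps, so each of them cuts off its own corner of the
  circle. They do not cross: a contradiction.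
\<close>

section \<open>Non-interleaving sets\<close>

text \<open>
  The relation is meant for sets of points of a circle that is cut open at one point: the two
  excluded patterns are the two ways in which pairs from \<open>X\<close> and from \<open>Y\<close> alternate cyclically.
  Sets with a common point count as linked, as do chords with a common endpoint.
\<close>

definition unlinked :: "'a::linorder set \<Rightarrow> 'a set \<Rightarrow> bool" where
  "unlinked X Y \<longleftrightarrow> X \<inter> Y = {} \<and>
     (\<forall>x\<in>X. \<forall>x'\<in>X. \<forall>y\<in>Y. \<forall>y'\<in>Y. \<not> (x < y \<and> y < x' \<and> x' < y') \<and> \<not> (y < x \<and> x < y' \<and> y' < x'))"

lemma unlinked_sym: "unlinked X Y \<Longrightarrow> unlinked Y X"
  unfolding unlinked_def by blast

lemma unlinked_mono: "unlinked X Y \<Longrightarrow> X' \<subseteq> X \<Longrightarrow> Y' \<subseteq> Y \<Longrightarrow> unlinked X' Y'"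
  unfolding unlinked_def by blast

text \<open>
  A convex set and its complement are complementary arcs of the circle.
\<close>

lemma unlinked_if_separated:
  assumes conv: "\<And>x y z. x \<in> C \<Longrightarrow> z \<in> C \<Longrightarrow> x \<le> y \<Longrightarrow> y \<le> z \<Longrightarrow> y \<in> C"
    and "X \<subseteq> C" "Y \<inter> C = {}"
  shows "unlinked X Y"
proof -
  have "X \<inter> Y = {}" using assms by blast
  moreover have "\<not> (x < y \<and> y < x')" if "x \<in> X" "x' \<in> X" "y \<in> Y" for x x' y
  proof
    assume "x < y \<and> y < x'"
    then have "y \<in> C" using conv[OF subsetD[OF assms(2)] subsetD[OF assms(2)]] that by (meson less_imp_le)
    then show False using that assms(3) by blast
  qed
  ultimately show ?thesis unfolding unlinked_def by (metis (no_types, lifting))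
qed

lemma unlinked_same_side:
  assumes "unlinked X Z" "z \<in> Z" "z' \<in> Z" "x \<in> X" "x' \<in> X" "x \<in> {z..z'}"
  shows "x' \<in> {z..z'}"
proof -
  have "x \<noteq> z" "x \<noteq> z'" using assms by (auto simp: unlinked_def)
  with assms have x: "z < x" "x < z'" by auto
  show ?thesis
  proof (rule ccontr)
    assume "x' \<notin> {z..z'}"
    then have "x' < z \<or> z' < x'" by auto
    with assms x show False unfolding unlinked_def by blast
  qed
qed

text \<open>
  If two points of \<open>Z\<close> separated a point of \<open>X\<close> from a point of \<open>Y\<close>, they would separate all of
  \<open>X\<close> from all of \<open>Y\<close>, and \<open>X\<close> and \<open>Y\<close> would not be linked.
\<close>

lemma unlinked_Un:
  assumes "\<not> unlinked X Y" "unlinked X Z" "unlinked Y Z"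
  shows "unlinked (X \<union> Y) Z"
proof -
  have sep: "y \<in> {z..z'}"
    if "\<not> unlinked V W" "unlinked V Z" "unlinked W Z" "x \<in> V" "y \<in> W" "z \<in> Z" "z' \<in> Z" "x \<in> {z..z'}"
    for V W x y z z'
  proof (rule ccontr)
    assume y: "y \<notin> {z..z'}"
    have "V \<subseteq> {z..z'}" using unlinked_same_side that by blast
    moreover have "W \<inter> {z..z'} = {}" using unlinked_same_side[of W Z z z' _ y] that y by blast
    ultimately have "unlinked V W" by (intro unlinked_if_separated[of "{z..z'}"]) auto
    then show False using that by blast
  qed
  have same: "y \<in> {z..z'}" if "x \<in> X \<union> Y" "y \<in> X \<union> Y" "z \<in> Z" "z' \<in> Z" "x \<in> {z..z'}" for x y z z'
    using that sep[of X Y] sep[of Y X] assms unlinked_same_side unlinked_sym by blast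
  have "(X \<union> Y) \<inter> Z = {}" using assms unfolding unlinked_def by blast
  moreover have False if "x \<in> X \<union> Y" "x' \<in> X \<union> Y" "z \<in> Z" "z' \<in> Z"
      "x < z \<and> z < x' \<and> x' < z' \<or> z < x \<and> x < z' \<and> z' < x'" for x x' z z'
    using same[of x' x z z'] same[of x x' z z'] that by force
  ultimately show ?thesis unfolding unlinked_def by blast
qed

lemma unlinked_UN_chain:
  assumes "m \<le> n" "\<And>k. m \<le> k \<Longrightarrow> k < n \<Longrightarrow> \<not> unlinked (P k) (P (Suc k))"
    and "\<And>k. m \<le> k \<Longrightarrow> k \<le> n \<Longrightarrow> unlinked (P k) Z"
  shows "unlinked (\<Union>k\<in>{m..n}. P k) Z"
  using assms
proof (induction n rule: dec_induct)
  case base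
  then show ?case by simp
next
  case (step n)
  have "unlinked (P (Suc n) \<union> (\<Union>k\<in>{m..n}. P k)) Z"
  proof (rule unlinked_Un)
    show "unlinked (\<Union>k\<in>{m..n}. P k) Z" using step by auto
    show "unlinked (P (Suc n)) Z" using step by auto
    have "\<not> unlinked (P n) (P (Suc n))" using step by auto
    moreover have "P n \<subseteq> (\<Union>k\<in>{m..n}. P k)" using step by auto
    ultimately show "\<not> unlinked (P (Suc n)) (\<Union>k\<in>{m..n}. P k)"
      using unlinked_mono unlinked_sym by blast
  qed
  then show ?case using step by (simp add: atLeastAtMostSuc_conv)
qed

text \<open>
  The chord \<open>{t, t'}\<close> lies outside the cap over \<open>[s, s']\<close>, and \<open>X\<close> is joined to it without
  crossing the chord \<open>{s, s'}\<close>, so it lies outside as well.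
\<close>

lemma linked_set_avoids_interval:
  assumes "s \<le> s'" "\<not> unlinked X {t, t'}" "unlinked X {s, s'}" "{t, t'} \<inter> {s..s'} = {}"
  shows "X \<inter> {s..s'} = {}"
proof -
  have "unlinked {t, t'} {s, s'}"
    using assms(1,4) by (intro unlinked_sym[OF unlinked_if_separated[of "{s..s'}" "{s, s'}" "{t, t'}"]]) auto
  then have "unlinked (X \<union> {t, t'}) {s, s'}" using assms by (intro unlinked_Un)
  then show ?thesis using unlinked_same_side[of "X \<union> {t, t'}" "{s, s'}" s s' _ t] assms(4) by blast
qed

text \<open>
  Crossing \<open>{s, s'}\<close> puts a point of \<open>X\<close> into the first cap, which excludes the second one, and
  \<open>X\<close> has to leave the first cap in order to reach \<open>Y\<close>.
\<close>

lemma chord_from_interval: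
  assumes "s \<le> s'" "t \<le> t'" "{s..s'} \<inter> {t..t'} = {}"
    and "\<not> unlinked X {s, s'}" "unlinked X {t, t'}" "\<not> unlinked X Y" "Y \<inter> {s..s'} = {}"
  shows "X \<inter> {s..s'} \<noteq> {}" "X \<inter> {t..t'} = {}" "X - {s..s'} - {t..t'} \<noteq> {}"
proof -
  show meets: "X \<inter> {s..s'} \<noteq> {}"
  proof
    assume "X \<inter> {s..s'} = {}"
    then have "unlinked {s, s'} X" using assms(1) by (intro unlinked_if_separated[of "{s..s'}"]) auto
    then show False using assms(4) unlinked_sym by blast
  qed
  show off: "X \<inter> {t..t'} = {}"
    using meets unlinked_same_side[OF assms(5), of t t'] assms(3) by blast
  have "\<not> X \<subseteq> {s..s'}"
  proof
    assume "X \<subseteq> {s..s'}"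
    then have "unlinked X Y" using assms(7) by (intro unlinked_if_separated[of "{s..s'}"]) auto
    then show False using assms(6) by blast
  qed
  then show "X - {s..s'} - {t..t'} \<noteq> {}" using off by blast
qed

section \<open>A path with two stars\<close>

text \<open>
  The sets \<open>P k\<close> stand for the path chords, \<open>{s, s'}\<close> and \<open>{t, t'}\<close> for the chords of the stars
  \<open>i\<close> and \<open>j\<close>. The circle is cut open outside the two caps \<open>[s, s']\<close> and \<open>[t, t']\<close>, so that one
  gap is the interval between them and the other one consists of the points left and right of
  both.
\<close>

locale path_with_two_stars =
  fixes P :: "nat \<Rightarrow> 'a::linorder set" and lo hi :: nat
    and w :: "nat \<Rightarrow> nat" and i j :: nat and s s' t t' :: 'a
  assumes ord: "s < s'" "s' < t" "t < t'"
    and path: "lo \<le> m \<Longrightarrow> m < n \<Longrightarrow> n \<le> hi \<Longrightarrow> unlinked (P m) (P n) \<longleftrightarrow> n \<noteq> Suc m"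
    and star_i: "lo \<le> k \<Longrightarrow> k \<le> hi \<Longrightarrow> unlinked (P k) {s, s'} \<longleftrightarrow> w k \<noteq> i"
    and star_j: "lo \<le> k \<Longrightarrow> k \<le> hi \<Longrightarrow> unlinked (P k) {t, t'} \<longleftrightarrow> w k \<noteq> j"
    and distinct_letters: "i \<noteq> j"
begin

abbreviation "strand m n \<equiv> (\<Union>k\<in>{m..n}. P k)"

abbreviation "free_points X \<equiv> X - {s..s'} - {t..t'}"

definition "in_gap x \<longleftrightarrow> s' < x \<and> x < t"

lemma unlinked_strand:
  assumes "lo \<le> m" "m \<le> n" "n \<le> hi" "\<And>k. m \<le> k \<Longrightarrow> k \<le> n \<Longrightarrow> unlinked (P k) Z"
  shows "unlinked (strand m n) Z"
  using assms path by (intro unlinked_UN_chain) auto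

lemma unlinked_strands:
  assumes "lo \<le> m" "m \<le> n" "n + 2 \<le> m'" "m' \<le> n'" "n' \<le> hi"
  shows "unlinked (strand m n) (strand m' n')"
proof -
  have "unlinked (strand m' n') (P k)" if "m \<le> k" "k \<le> n" for k
    using assms that path[of k] by (intro unlinked_strand) (auto intro!: unlinked_sym[of "P k"])
  then show ?thesis
    using assms by (intro unlinked_strand) (auto intro: unlinked_sym)
qed

lemma intervals_disjoint: "{s..s'} \<inter> {t..t'} = {}" "{t..t'} \<inter> {s..s'} = {}"
  "{t, t'} \<inter> {s..s'} = {}" "{s, s'} \<inter> {t..t'} = {}"
proof -
  have False if "x \<le> s'" "t \<le> x" for x using that ord(2) by order
  then show "{s..s'} \<inter> {t..t'} = {}" "{t..t'} \<inter> {s..s'} = {}" by auto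
  moreover have "{s, s'} \<subseteq> {s..s'}" "{t, t'} \<subseteq> {t..t'}" using ord by (simp_all add: less_imp_le)
  ultimately show "{t, t'} \<inter> {s..s'} = {}" "{s, s'} \<inter> {t..t'} = {}" by blast+
qed

lemma linked_strand:
  assumes "\<not> unlinked (P k) Z" "m \<le> k" "k \<le> n"
  shows "\<not> unlinked (strand m n) Z"
proof -
  have "P k \<subseteq> strand m n" using assms by force
  then show ?thesis using assms(1) unlinked_mono by blast
qed

lemma strand_avoids_s:
  assumes "lo \<le> m" "n \<le> hi" "\<And>k. m \<le> k \<Longrightarrow> k \<le> n \<Longrightarrow> w k \<noteq> i" "m \<le> k" "k \<le> n" "w k = j"
  shows "strand m n \<inter> {s..s'} = {}"
proof (rule linked_set_avoids_interval)
  show "\<not> unlinked (strand m n) {t, t'}"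
    using assms star_j[of k] by (intro linked_strand[of k]) auto
  show "unlinked (strand m n) {s, s'}" using assms star_i by (intro unlinked_strand) auto
  show "s \<le> s'" using ord by simp
qed (rule intervals_disjoint)

lemma strand_avoids_t:
  assumes "lo \<le> m" "n \<le> hi" "\<And>k. m \<le> k \<Longrightarrow> k \<le> n \<Longrightarrow> w k \<noteq> j" "m \<le> k" "k \<le> n" "w k = i"
  shows "strand m n \<inter> {t..t'} = {}"
proof (rule linked_set_avoids_interval)
  show "\<not> unlinked (strand m n) {s, s'}"
    using assms star_i[of k] by (intro linked_strand[of k]) auto
  show "unlinked (strand m n) {t, t'}" using assms star_j by (intro unlinked_strand) auto
  show "t \<le> t'" using ord by simp
qed (rule intervals_disjoint)

lemma linked_neighbours:
  assumes "lo \<le> p" "p \<le> hi" "lo \<le> q" "q \<le> hi" "q = Suc p \<or> p = Suc q"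
  shows "\<not> unlinked (P p) (P q)"
proof
  assume "unlinked (P p) (P q)"
  then show False using path[of p q] path[of q p] unlinked_sym[of "P p" "P q"] assms by auto
qed

lemma end_chord_i:
  assumes "lo \<le> p" "p \<le> hi" "lo \<le> q" "q \<le> hi" "q = Suc p \<or> p = Suc q" "w p = i" "P q \<inter> {s..s'} = {}"
  shows "P p \<inter> {s..s'} \<noteq> {}" "P p \<inter> {t..t'} = {}" "free_points (P p) \<noteq> {}"
proof -
  have "\<not> unlinked (P p) {s, s'}" "unlinked (P p) {t, t'}"
    using star_i[of p] star_j[of p] assms(1,2,6) distinct_letters by simp_all
  from chord_from_interval[OF less_imp_le[OF ord(1)] less_imp_le[OF ord(3)] intervals_disjoint(1) this
      linked_neighbours[OF assms(1-5)] assms(7)]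
  show "P p \<inter> {s..s'} \<noteq> {}" "P p \<inter> {t..t'} = {}" "free_points (P p) \<noteq> {}" by blast+
qed

lemma end_chord_j:
  assumes "lo \<le> p" "p \<le> hi" "lo \<le> q" "q \<le> hi" "q = Suc p \<or> p = Suc q" "w p = j" "P q \<inter> {t..t'} = {}"
  shows "P p \<inter> {t..t'} \<noteq> {}" "P p \<inter> {s..s'} = {}" "free_points (P p) \<noteq> {}"
proof -
  have "\<not> unlinked (P p) {t, t'}" "unlinked (P p) {s, s'}"
    using star_i[of p] star_j[of p] assms(1,2,6) distinct_letters by simp_all
  note * = chord_from_interval[OF less_imp_le[OF ord(3)] less_imp_le[OF ord(1)] intervals_disjoint(2) this
      linked_neighbours[OF assms(1-5)] assms(7)]
  show "P p \<inter> {t..t'} \<noteq> {}" "P p \<inter> {s..s'} = {}" by (fact *)+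
  show "free_points (P p) \<noteq> {}" using *(3) by blast
qed

definition "alternates a b \<longleftrightarrow> a < b \<and> {w a, w b} = {i, j} \<and> (\<forall>k. a < k \<and> k < b \<longrightarrow> w k \<noteq> i \<and> w k \<noteq> j)"

text \<open>
  All chords of the strand except the one at the letter \<open>i\<close> avoid the star \<open>i\<close> and are connected
  to the star \<open>j\<close>, so they stay outside the cap of \<open>i\<close>; likewise with \<open>i\<close> and \<open>j\<close> exchanged.
  Since the alternance may start with either letter, \<open>p\<close> is \<open>a\<close> or \<open>b\<close>, whichever carries \<open>i\<close>.
\<close>

lemma alternance_strand:
  assumes "lo \<le> a" "b \<le> hi" "alternates a b"
  shows "\<exists>p q. {p, q} = {a, b} \<and> P p \<inter> {s..s'} \<noteq> {} \<and> P p \<inter> {t..t'} = {} \<and>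
           P q \<inter> {t..t'} \<noteq> {} \<and> P q \<inter> {s..s'} = {}"
    and "a \<le> k \<Longrightarrow> k \<le> b \<Longrightarrow> free_points (P k) \<noteq> {}"
proof -
  have ab: "a < b" and mid: "\<And>k. a < k \<Longrightarrow> k < b \<Longrightarrow> w k \<noteq> i \<and> w k \<noteq> j"
    using assms by (simp_all add: alternates_def)
  have letters: "w a = i \<and> w b = j \<or> w a = j \<and> w b = i"
    using assms(3) unfolding alternates_def doubleton_eq_iff by blast
  have after: "w k \<noteq> c" if "c \<in> {i, j}" "w b \<noteq> c" "Suc a \<le> k" "k \<le> b" for c k
  proof (cases "k = b")
    case False
    with that have "a < k" "k < b" by linarith+
    then show ?thesis using mid that by blast
  qed (use that in simp)
  have before: "w k \<noteq> c" if "c \<in> {i, j}" "w a \<noteq> c" "a \<le> k" "k \<le> b - 1" for c k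
  proof (cases "k = a")
    case False
    with that ab have "a < k" "k < b" by linarith+
    then show ?thesis using mid that by blast
  qed (use that in simp)
  have in_strands: "P k \<subseteq> strand (Suc a) b" "P k \<subseteq> strand a (b - 1)" if "a < k" "k < b" for k
    using that by force+
  have ends_in_strands: "P b \<subseteq> strand (Suc a) b" "P (Suc a) \<subseteq> strand (Suc a) b"
      "P a \<subseteq> strand a (b - 1)" "P (b - 1) \<subseteq> strand a (b - 1)"
    using ab by force+
  have sub: "X \<inter> Z = {}" if "X \<subseteq> Y" "Y \<inter> Z = {}" for X Y Z :: "'a set"
    using that by blast
  obtain p q where pq: "{p, q} = {a, b}" "P p \<inter> {s..s'} \<noteq> {}" "P p \<inter> {t..t'} = {}"
      "P q \<inter> {t..t'} \<noteq> {}" "P q \<inter> {s..s'} = {}" "free_points (P p) \<noteq> {}" "free_points (P q) \<noteq> {}"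
    and inner: "\<And>k. a < k \<Longrightarrow> k < b \<Longrightarrow> P k \<inter> {s..s'} = {} \<and> P k \<inter> {t..t'} = {}"
  proof (cases "w a = i")
    case True
    then have w: "w a = i" "w b = j" using letters distinct_letters by metis+
    have S: "strand (Suc a) b \<inter> {s..s'} = {}"
      using after[of i] assms ab w distinct_letters by (intro strand_avoids_s[of _ _ b]) auto
    have T: "strand a (b - 1) \<inter> {t..t'} = {}"
      using before[of j] assms ab w distinct_letters by (intro strand_avoids_t[of _ _ a]) auto
    note ends = end_chord_i[OF _ _ _ _ _ w(1) sub[OF ends_in_strands(2) S]]
      end_chord_j[OF _ _ _ _ _ w(2) sub[OF ends_in_strands(4) T]]
    show ?thesis
    proof (rule that[of a b])
      show "P k \<inter> {s..s'} = {} \<and> P k \<inter> {t..t'} = {}" if "a < k" "k < b" for k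
        using sub[OF in_strands(1)[OF that] S] sub[OF in_strands(2)[OF that] T] by blast
    qed (use assms ab ends in auto)
  next
    case False
    then have w: "w a = j" "w b = i" using letters distinct_letters by metis+
    have T: "strand (Suc a) b \<inter> {t..t'} = {}"
      using after[of j] assms ab w distinct_letters by (intro strand_avoids_t[of _ _ b]) auto
    have S: "strand a (b - 1) \<inter> {s..s'} = {}"
      using before[of i] assms ab w distinct_letters by (intro strand_avoids_s[of _ _ a]) auto
    note ends = end_chord_j[OF _ _ _ _ _ w(1) sub[OF ends_in_strands(2) T]]
      end_chord_i[OF _ _ _ _ _ w(2) sub[OF ends_in_strands(4) S]]
    show ?thesis
    proof (rule that[of b a])
      show "P k \<inter> {s..s'} = {} \<and> P k \<inter> {t..t'} = {}" if "a < k" "k < b" for k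
        using sub[OF in_strands(1)[OF that] T] sub[OF in_strands(2)[OF that] S] by blast
    qed (use assms ab ends in auto)
  qed
  then show "\<exists>p q. {p, q} = {a, b} \<and> P p \<inter> {s..s'} \<noteq> {} \<and> P p \<inter> {t..t'} = {} \<and>
           P q \<inter> {t..t'} \<noteq> {} \<and> P q \<inter> {s..s'} = {}" by blast
  show "free_points (P k) \<noteq> {}" if "a \<le> k" "k \<le> b"
  proof (cases "k = a \<or> k = b")
    case True
    then show ?thesis using pq by (auto simp: doubleton_eq_iff)
  next
    case False
    then have k: "a < k" "k < b" using that by auto
    have "P k \<noteq> {}" using linked_neighbours[of k "Suc k"] k assms by (auto simp: unlinked_def)
    then show ?thesis using inner[OF k] by blast
  qed
qed

lemma alternance_strand_spans:
  assumes "lo \<le> a" "b \<le> hi" "alternates a b"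
  shows "strand a b \<inter> {s..s'} \<noteq> {}" "strand a b \<inter> {t..t'} \<noteq> {}"
proof -
  obtain p q where pq: "{p, q} = {a, b}" "P p \<inter> {s..s'} \<noteq> {}" "P q \<inter> {t..t'} \<noteq> {}"
    using alternance_strand(1)[OF assms] by blast
  moreover have "a < b" using assms by (simp add: alternates_def)
  ultimately have "p \<in> {a..b}" "q \<in> {a..b}" by (auto simp: doubleton_eq_iff)
  then show "strand a b \<inter> {s..s'} \<noteq> {}" "strand a b \<inter> {t..t'} \<noteq> {}" using pq(2,3) by blast+
qed

text \<open>
  Both sets have points in both caps. If in addition both had a point in the same gap, then
  neither of the two triples would lie within one of the arcs that the other one leaves. The five cases are the
  positions of the two gap points relative to the place where the circle is cut open.
\<close>

lemma spanning_strands_opposite: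
  assumes "unlinked X Y" "x \<in> free_points X" "y \<in> free_points Y"
    and "X \<inter> {s..s'} \<noteq> {}" "X \<inter> {t..t'} \<noteq> {}" "Y \<inter> {s..s'} \<noteq> {}" "Y \<inter> {t..t'} \<noteq> {}"
  shows "in_gap x \<noteq> in_gap y"
proof
  assume same: "in_gap x = in_gap y"
  obtain l r l' r' where m: "l \<in> X" "r \<in> X" "x \<in> X" "l' \<in> Y" "r' \<in> Y" "y \<in> Y"
    and b: "s \<le> l" "l \<le> s'" "t \<le> r" "r \<le> t'" "s \<le> l'" "l' \<le> s'" "t \<le> r'" "r' \<le> t'"
  proof -
    obtain l r l' r' where "l \<in> X" "l \<in> {s..s'}" "r \<in> X" "r \<in> {t..t'}"
      "l' \<in> Y" "l' \<in> {s..s'}" "r' \<in> Y" "r' \<in> {t..t'}"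
      using assms(4-7) by blast
    then show thesis using assms(2,3) by (intro that[of l r l' r']) auto
  qed
  have ne: "x \<noteq> y" "l \<noteq> l'" "r \<noteq> r'" using m assms(1) by (auto simp: unlinked_def)
  have free: "(s' < x \<and> x < t \<or> x < s \<or> t' < x)" "(s' < y \<and> y < t \<or> y < s \<or> t' < y)"
    using assms ord by auto
  have nolink: "\<not> (u < v \<and> v < u' \<and> u' < v')" "\<not> (v < u \<and> u < v' \<and> v' < u')"
    if "u \<in> X" "u' \<in> X" "v \<in> Y" "v' \<in> Y" for u u' v v'
    using assms(1) that unfolding unlinked_def by blast+
  have lr: "l < r" "l < r'" "l' < r" "l' < r'" using b ord by order+
  consider (both_between) "s' < x" "x < t" "s' < y" "y < t" | (low) "x < s" "y < s" | (high) "t' < x" "t' < y"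
    | (low_high) "x < s" "t' < y" | (high_low) "t' < x" "y < s"
    using same free ord unfolding in_gap_def by (metis less_trans less_asym)
  then show False
  proof cases
    case both_between
    then have "l < x" "l < y" "l' < x" "l' < y" "x < r" "y < r" "x < r'" "y < r'" using b by order+
    then show ?thesis using nolink[of x r l' y] nolink[of l x y r'] ne m by (metis linorder_neqE)
  next
    case low
    then have "x < l" "x < l'" "y < l" "y < l'" using b by order+
    then show ?thesis using nolink[of x l y r'] nolink[of x r y l'] ne m lr by (metis linorder_neqE)
  next
    case high
    then have "r < x" "r' < x" "r < y" "r' < y" using b by order+
    then show ?thesis using nolink[of l x r' y] nolink[of r x l' y] ne m lr by (metis linorder_neqE)
  next
    case low_high
    then have "x < l" "x < l'" "r < y" "r' < y" using b by order+
    then show ?thesis using nolink[of l r l' y] nolink[of x l l' r'] ne m lr by (metis linorder_neqE)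
  next
    case high_low
    then have "y < l" "y < l'" "r < x" "r' < x" using b by order+
    then show ?thesis using nolink[of l r y l'] nolink[of l x l' r'] ne m lr by (metis linorder_neqE)
  qed
qed

text \<open>
  A point of \<open>X\<close> in each cap already separates the two gaps from each other.
\<close>

lemma strand_one_side:
  assumes "unlinked X Y" "x \<in> free_points Y" "y \<in> free_points Y"
    and "X \<inter> {s..s'} \<noteq> {}" "X \<inter> {t..t'} \<noteq> {}"
  shows "in_gap x = in_gap y"
proof -
  obtain l r where lr: "l \<in> X" "r \<in> X" "s \<le> l" "l \<le> s'" "t \<le> r" "r \<le> t'"
  proof -
    obtain l r where "l \<in> X" "l \<in> {s..s'}" "r \<in> X" "r \<in> {t..t'}" using assms(4,5) by blast
    then show thesis by (intro that[of l r]) auto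
  qed
  have "in_gap u = (u \<in> {l..r})" if "u \<in> free_points Y" for u
    using that lr ord by (auto simp: in_gap_def)
  moreover have "x \<in> {l..r} \<longleftrightarrow> y \<in> {l..r}"
    using unlinked_same_side[of Y X l r] assms lr unlinked_sym by blast
  ultimately show ?thesis using assms by blast
qed

theorem no_three_separate_alternances:
  assumes "lo \<le> a" "alternates a b" "b < a'" "alternates a' b'" "b' < a''" "alternates a'' b''" "b'' \<le> hi"
  shows False
proof -
  have less: "a < b" "a' < b'" "a'' < b''" using assms by (auto simp: alternates_def)
  have bounds: "b \<le> hi" "lo \<le> a'" "b' \<le> hi" "lo \<le> a''" using assms less by linarith+
  note alt = alternance_strand[OF assms(1) bounds(1) assms(2)]
    and alt' = alternance_strand[OF bounds(2,3) assms(4)]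
    and alt'' = alternance_strand[OF bounds(4) assms(7,6)]
  have "free_points (P a) \<noteq> {}" "free_points (P b'') \<noteq> {}"
    using alt(2)[of a] alt''(2)[of b''] less by simp_all
  then obtain x y where x: "x \<in> free_points (P a)" and y: "y \<in> free_points (P b'')" by blast
  have strand_ends: "P m \<subseteq> strand m n" "P n \<subseteq> strand m n" if "m < n" for m n
    using that by force+
  note span = alternance_strand_spans[OF assms(1) bounds(1) assms(2)]
    alternance_strand_spans[OF bounds(4) assms(7,6)]
  have xy: "in_gap x \<noteq> in_gap y"
  proof (rule spanning_strands_opposite[OF _ _ _ span])
    show "unlinked (strand a b) (strand a'' b'')" using assms less by (intro unlinked_strands) auto
    show "x \<in> free_points (strand a b)" using x strand_ends[OF less(1)] by blast
    show "y \<in> free_points (strand a'' b'')" using y strand_ends[OF less(3)] by blast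
  qed
  have late: "in_gap z = in_gap y" if "b + 2 \<le> k" "k \<le> b''" "z \<in> free_points (P k)" for k z
  proof (rule strand_one_side[OF _ _ _ span(1,2)])
    show "unlinked (strand a b) (strand (b + 2) b'')"
      using assms less that by (intro unlinked_strands) auto
    have "k \<in> {b + 2..b''}" "b'' \<in> {b + 2..b''}" using that by auto
    then show "z \<in> free_points (strand (b + 2) b'')" "y \<in> free_points (strand (b + 2) b'')"
      using y that(3) by blast+
  qed
  have early: "in_gap z = in_gap x" if "a \<le> k" "k + 2 \<le> a''" "z \<in> free_points (P k)" for k z
  proof (rule strand_one_side[OF _ _ _ span(3,4)])
    have "unlinked (strand a (a'' - 2)) (strand a'' b'')"
      using assms less that by (intro unlinked_strands) auto
    then show "unlinked (strand a'' b'') (strand a (a'' - 2))" by (rule unlinked_sym)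
    have "k \<in> {a..a'' - 2}" "a \<in> {a..a'' - 2}" using that by auto
    then show "z \<in> free_points (strand a (a'' - 2))" "x \<in> free_points (strand a (a'' - 2))"
      using x that(3) by blast+
  qed
  \<comment> \<open>The gap points of such a chord would lie in the gap of the first and in the gap of the last
    alternance.\<close>
  have no_mid: False if k: "a' \<le> k" "k \<le> b'" "b + 2 \<le> k" "k + 2 \<le> a''" for k
  proof -
    obtain z where "z \<in> free_points (P k)" using alt'(2)[of k] k by blast
    then show False using late[of k z] early[of k z] xy k assms(1,3,5) less by simp
  qed
  have "b' = Suc a'"
  proof (rule ccontr)
    assume "b' \<noteq> Suc a'"
    with less assms(3,5) show False by (intro no_mid[of "Suc a'"]) linarith+
  qed
  moreover have "a' = Suc b"
  proof (rule ccontr)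
    assume "a' \<noteq> Suc b"
    with less assms(3,5) show False by (intro no_mid[of "a'"]) linarith+
  qed
  moreover have "a'' = Suc b'"
  proof (rule ccontr)
    assume "a'' \<noteq> Suc b'"
    with less assms(3,5) show False by (intro no_mid[of "b'"]) linarith+
  qed
  ultimately have tight: "b' = Suc a'" "a' = Suc b" "a'' = Suc b'" by simp_all
  have link: "\<not> unlinked (P a') (P b')" using path[of a' b'] bounds tight by simp
  have xa: "in_gap z = in_gap x" if "z \<in> free_points (P a')" for z
    using early[of a' z] that less tight by simp
  have yb: "in_gap z = in_gap y" if "z \<in> free_points (P b')" for z
    using late[of b' z] that less tight by simp
  obtain p q where pq: "{p, q} = {a', b'}" "P p \<inter> {t..t'} = {}" "P q \<inter> {s..s'} = {}"
    using alt'(1) by blast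
  then have link: "\<not> unlinked (P p) (P q)"
    using link unlinked_sym pq(1) unfolding doubleton_eq_iff by blast
  \<comment> \<open>The chord \<open>p\<close> starts in the first cap, \<open>q\<close> in the second, and \<open>\<beta>\<close> says whether \<open>p\<close> ends in
    the gap between the caps.\<close>
  obtain \<beta> where p: "\<And>z. z \<in> free_points (P p) \<Longrightarrow> in_gap z = \<beta>"
    and q: "\<And>z. z \<in> free_points (P q) \<Longrightarrow> in_gap z = (\<not> \<beta>)"
    using xa yb xy pq(1) by (metis doubleton_eq_iff)
  have p': "z \<in> {s..s'} \<or> in_gap z = \<beta>" if "z \<in> P p" for z using p that pq by blast
  have q': "z \<in> {t..t'} \<or> in_gap z = (\<not> \<beta>)" if "z \<in> P q" for z using q that pq by blast
  show False
  proof (cases \<beta>)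
    case True
    have "z \<in> {s..<t}" if "z \<in> P p" for z using p'[OF that] True ord by (auto simp: in_gap_def)
    moreover have "z \<notin> {s..<t}" if "z \<in> P q" for z
      using q'[OF that] pq(3) that True ord by (auto simp: in_gap_def)
    ultimately have "unlinked (P p) (P q)" by (intro unlinked_if_separated[of "{s..<t}"]) auto
    then show False using link by blast
  next
    case False
    have "z \<in> {s'<..t'}" if "z \<in> P q" for z using q'[OF that] False ord by (auto simp: in_gap_def)
    moreover have "z \<notin> {s'<..t'}" if "z \<in> P p" for z
      using p'[OF that] pq(2) that False ord by (auto simp: in_gap_def)
    ultimately have "unlinked (P q) (P p)" by (intro unlinked_if_separated[of "{s'<..t'}"]) auto
    then show False using link unlinked_sym by blast
  qed
qed

end

section \<open>Chords of a circle as pairs of angles\<close>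

text \<open>
  Twice the signed area of the triangle \<open>p q x\<close>, positive if it is run through counterclockwise.
\<close>

definition orientation :: "complex \<Rightarrow> complex \<Rightarrow> complex \<Rightarrow> real" where
  "orientation p q x = Im (cnj (q - p) * (x - p))"

lemma orientation_expand:
  "orientation p q x = (Re q - Re p) * (Im x - Im p) - (Im q - Im p) * (Re x - Re p)"
  by (simp add: orientation_def algebra_simps)

lemma sin_double_sum: "sin (2 * u) + sin (2 * v) - sin (2 * u + 2 * v) = 4 * sin u * sin v * sin (u + v)" for u v :: real
proof -
  have "sin (2 * u) + sin (2 * v) - sin (2 * u + 2 * v) =
      2 * sin u * cos u * (1 - cos (2 * v)) + 2 * sin v * cos v * (1 - cos (2 * u))"
    unfolding sin_add sin_double by (simp add: algebra_simps)
  also have "1 - cos (2 * v) = 2 * (sin v)\<^sup>2" by (simp add: cos_double_sin)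
  also have "1 - cos (2 * u) = 2 * (sin u)\<^sup>2" by (simp add: cos_double_sin)
  finally show ?thesis by (simp add: sin_add power2_eq_square algebra_simps)
qed

text \<open>
  In this product form the sign of the orientation can be read off from the order of the angles:
  half the difference of two angles of \<open>[0, 2 \<pi>)\<close> lies between \<open>- \<pi>\<close> and \<open>\<pi>\<close>.
\<close>

lemma orientation_circle:
  "orientation (z + d * cis a) (z + d * cis b) (z + d * cis x) =
     4 * (cmod d)\<^sup>2 * sin ((b - a) / 2) * sin ((x - b) / 2) * sin ((x - a) / 2)"
proof -
  have "cnj (d * cis b - d * cis a) * (d * cis x - d * cis a) =
      (d * cnj d) * (cnj (cis b - cis a) * (cis x - cis a))"
    by (simp add: algebra_simps)
  also have "d * cnj d = of_real ((cmod d)\<^sup>2)" by (rule complex_norm_square[symmetric])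
  finally have "orientation (z + d * cis a) (z + d * cis b) (z + d * cis x) =
      (cmod d)\<^sup>2 * Im (cnj (cis b - cis a) * (cis x - cis a))"
    unfolding orientation_def by simp
  also have "Im (cnj (cis b - cis a) * (cis x - cis a)) = sin (b - a) + sin (x - b) - sin (x - a)"
    by (simp add: sin_diff algebra_simps)
  also have "\<dots> = 4 * sin ((b - a) / 2) * sin ((x - b) / 2) * sin ((x - a) / 2)"
  proof -
    have "2 * ((b - a) / 2) = b - a" "2 * ((x - b) / 2) = x - b" "b - a + (x - b) = x - a"
      "(b - a) / 2 + (x - b) / 2 = (x - a) / 2" by (simp_all add: field_simps)
    then show ?thesis using sin_double_sum[of "(b - a) / 2" "(x - b) / 2"] by metis
  qed
  finally show ?thesis by simp
qed

lemma sin_half_pos: "0 < sin (x / 2)" if "0 < x" "x < 2 * pi" for x :: real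
  using that by (intro sin_gt_zero) auto

lemma orientation_pos:
  assumes "d \<noteq> 0" "a < b" "b < x" "x - a < 2 * pi"
  shows "0 < orientation (z + d * cis a) (z + d * cis b) (z + d * cis x)"
  unfolding orientation_circle using assms by (intro mult_pos_pos sin_half_pos) auto

lemma orientation_rotate: "orientation q x p = orientation p q x"
  by (simp add: orientation_expand algebra_simps)

lemma orientation_flip: "orientation p x q = - orientation p q x"
  by (simp add: orientation_expand algebra_simps)

lemma orientation_segment:
  "orientation p q ((1 - t) *\<^sub>R u + t *\<^sub>R v) = (1 - t) * orientation p q u + t * orientation p q v"
  by (simp add: orientation_expand algebra_simps)

lemma orientation_on_segment: "w \<in> closed_segment p q \<Longrightarrow> orientation p q w = 0"
  unfolding closed_segment_def by (auto simp: orientation_segment) (simp add: orientation_expand)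

text \<open>
  The diagonals of a convex quadrilateral meet. The four triangle areas are the coefficients of
  the affine dependence of the corners, and this dependence exhibits one point as a convex
  combination of \<open>a\<close> and \<open>c\<close> and also of \<open>b\<close> and \<open>d\<close>.
\<close>

lemma crossing_segments_meet:
  assumes "0 < orientation a b c" "0 < orientation a b d" "0 < orientation a c d" "0 < orientation b c d"
  shows "closed_segment a c \<inter> closed_segment b d \<noteq> {}"
proof -
  define A B C D where "A = orientation b c d" and "B = orientation a c d"
    and "C = orientation a b d" and "D = orientation a b c"
  note defs = A_def B_def C_def D_def
  have pos: "0 < A" "0 < B" "0 < C" "0 < D" using assms by (auto simp: defs)
  have total: "A + C = B + D" by (simp add: defs orientation_expand algebra_simps)
  have "A *\<^sub>R a + C *\<^sub>R c = B *\<^sub>R b + D *\<^sub>R d"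
    by (simp add: defs orientation_expand complex_eq_iff algebra_simps)
  then have "(1 / (A + C)) *\<^sub>R (A *\<^sub>R a + C *\<^sub>R c) = (1 / (A + C)) *\<^sub>R (B *\<^sub>R b + D *\<^sub>R d)" by simp
  then have "(A / (A + C)) *\<^sub>R a + (C / (A + C)) *\<^sub>R c = (B / (B + D)) *\<^sub>R b + (D / (B + D)) *\<^sub>R d"
    by (simp add: scaleR_add_right total)
  moreover have "A / (A + C) = 1 - C / (A + C)" "B / (B + D) = 1 - D / (B + D)"
    using pos by (simp_all add: field_simps)
  ultimately have "(1 - C / (A + C)) *\<^sub>R a + (C / (A + C)) *\<^sub>R c = (1 - D / (B + D)) *\<^sub>R b + (D / (B + D)) *\<^sub>R d"
    by simp
  moreover have "0 \<le> C / (A + C)" "C / (A + C) \<le> 1" "0 \<le> D / (B + D)" "D / (B + D) \<le> 1" using pos by auto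
  ultimately show ?thesis unfolding closed_segment_def by blast
qed

lemma same_side_segments_disjoint:
  assumes "0 < orientation p q u * orientation p q v"
  shows "closed_segment p q \<inter> closed_segment u v = {}"
proof -
  have False if w: "w \<in> closed_segment p q" "w \<in> closed_segment u v" for w
  proof -
    obtain t where t: "0 \<le> t" "t \<le> 1" "w = (1 - t) *\<^sub>R u + t *\<^sub>R v"
      using w(2) unfolding closed_segment_def by blast
    have zero: "(1 - t) * orientation p q u + t * orientation p q v = 0"
      using orientation_on_segment[OF w(1)] t(3) orientation_segment by simp
    have pos: "0 < (1 - t) * a + t * b" if "0 < a" "0 < b" for a b
      using t that by (cases "t = 0") (auto intro!: add_nonneg_pos mult_nonneg_nonneg mult_pos_pos)
    show False
      using assms pos[of "orientation p q u" "orientation p q v"] pos[of "- orientation p q u" "- orientation p q v"] zero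
      by (auto simp: zero_less_mult_iff algebra_simps)
  qed
  then show ?thesis by blast
qed

text \<open>
  Any range of angles shorter than \<open>2 \<pi>\<close> serves, wherever the circle is cut open.
  Interleaving endpoints form a convex quadrilateral with the chords as diagonals; otherwise the
  endpoints of one chord lie strictly on one side of the other.
\<close>

lemma chords_disjoint_iff_unlinked:
  fixes z d :: complex
  defines "e \<equiv> \<lambda>x. z + d * cis x"
  assumes "d \<noteq> 0" "x \<noteq> y" "u \<noteq> v"
    and spread: "\<And>a b. a \<in> {x, y, u, v} \<Longrightarrow> b \<in> {x, y, u, v} \<Longrightarrow> a - b < 2 * pi"
  shows "closed_segment (e x) (e y) \<inter> closed_segment (e u) (e v) = {} \<longleftrightarrow> unlinked {x, y} {u, v}"
proof -
  have main: "closed_segment (e x) (e y) \<inter> closed_segment (e u) (e v) = {} \<longleftrightarrow> unlinked {x, y} {u, v}"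
    if "x < y" "u < v" and spread: "\<And>a b. a \<in> {x, y, u, v} \<Longrightarrow> b \<in> {x, y, u, v} \<Longrightarrow> a - b < 2 * pi"
    for x y u v
  proof
    assume disj: "closed_segment (e x) (e y) \<inter> closed_segment (e u) (e v) = {}"
    have pos: "0 < orientation (e a) (e b) (e c)" if "a < b" "b < c" "c - a < 2 * pi" for a b c
      unfolding e_def using \<open>d \<noteq> 0\<close> that by (rule orientation_pos)
    have "x \<noteq> u" "x \<noteq> v" "y \<noteq> u" "y \<noteq> v" using disj ends_in_segment by blast+
    moreover have "\<not> (x < u \<and> u < y \<and> y < v)"
    proof
      assume "x < u \<and> u < y \<and> y < v"
      then have "closed_segment (e x) (e y) \<inter> closed_segment (e u) (e v) \<noteq> {}"
        using spread[of v x] spread[of y x] spread[of v u] by (intro crossing_segments_meet pos) auto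
      then show False using disj by blast
    qed
    moreover have "\<not> (u < x \<and> x < v \<and> v < y)"
    proof
      assume "u < x \<and> x < v \<and> v < y"
      then have "closed_segment (e u) (e v) \<inter> closed_segment (e x) (e y) \<noteq> {}"
        using spread[of y u] spread[of v u] spread[of y x] by (intro crossing_segments_meet pos) auto
      then show False using disj by blast
    qed
    ultimately show "unlinked {x, y} {u, v}"
      using that(1,2) unfolding unlinked_def by auto
  next
    assume un: "unlinked {x, y} {u, v}"
    have inside: "orientation (e x) (e y) (e w) < 0" if "w \<in> {u, v}" "x < w" "w < y" for w
      using orientation_pos[of d x w y z] orientation_flip[of "e x" "e y" "e w"] spread[of y x] that \<open>d \<noteq> 0\<close>
      by (simp add: e_def)
    have outside: "orientation (e x) (e y) (e w) > 0" if "w \<in> {u, v}" "w < x \<or> y < w" for w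
      using orientation_pos[of d x y w z] orientation_pos[of d w x y z] orientation_rotate[of "e x" "e y" "e w"]
        spread[of w x] spread[of y w] that \<open>x < y\<close> \<open>d \<noteq> 0\<close>
      by (auto simp: e_def)
    have "(x < u \<and> u < y \<and> x < v \<and> v < y) \<or> ((u < x \<or> y < u) \<and> (v < x \<or> y < v))"
      using un that(1,2) unfolding unlinked_def by auto
    then have "0 < orientation (e x) (e y) (e u) * orientation (e x) (e y) (e v)"
      using inside outside by (auto intro: mult_neg_neg mult_pos_pos)
    then show "closed_segment (e x) (e y) \<inter> closed_segment (e u) (e v) = {}"
      by (rule same_side_segments_disjoint)
  qed
  define x1 y1 u1 v1 where "x1 = min x y" and "y1 = max x y" and "u1 = min u v" and "v1 = max u v"
  note defs = this
  have eqs: "closed_segment (e x1) (e y1) = closed_segment (e x) (e y)" "{x1, y1} = {x, y}"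
    "closed_segment (e u1) (e v1) = closed_segment (e u) (e v)" "{u1, v1} = {u, v}"
    by (auto simp: defs min_def max_def closed_segment_commute)
  have "{x1, y1, u1, v1} = {x1, y1} \<union> {u1, v1}" "{x, y, u, v} = {x, y} \<union> {u, v}" by auto
  then have "{x1, y1, u1, v1} = {x, y, u, v}" by (simp only: eqs)
  moreover have "x1 < y1" "u1 < v1" using assms(3,4) by (auto simp: defs)
  ultimately show ?thesis using main[of x1 y1 u1 v1] spread unfolding eqs by presburger
qed

lemma angle_coordinate:
  assumes "0 < r" "q \<in> sphere z r"
  obtains angle :: "complex \<Rightarrow> real" where
    "\<And>p. p \<in> sphere z r \<Longrightarrow> z + (q - z) * cis (angle p) = p"
    "\<And>p. 0 \<le> angle p" "\<And>p. angle p < 2 * pi" "angle q = 0"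
proof
  define angle where "angle p = Arg2pi ((p - z) / (q - z))" for p
  have q: "cmod (q - z) = r" using assms by (simp add: dist_norm norm_minus_commute)
  then have "q - z \<noteq> 0" using assms by auto
  show "z + (q - z) * cis (angle p) = p" if "p \<in> sphere z r" for p
  proof -
    have "cmod (p - z) = r" using that by (simp add: dist_norm norm_minus_commute)
    then have "cmod ((p - z) / (q - z)) = 1" using q assms(1) by (simp add: norm_divide)
    then have "cis (angle p) = (p - z) / (q - z)"
      unfolding angle_def by (simp add: complex_norm_eq_1_exp cis_conv_exp)
    then show ?thesis using \<open>q - z \<noteq> 0\<close> by simp
  qed
  show "0 \<le> angle p" "angle p < 2 * pi" for p using Arg2pi by (simp_all add: angle_def)
  show "angle q = 0" using \<open>q - z \<noteq> 0\<close> Arg2pi_unique[of 1 0 1] by (simp add: angle_def)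
qed

section \<open>The induced subgraph and its alternances\<close>

lemma path_star_class_induced_copy:
  assumes "infinite_word \<alpha>" "finite W" "W \<subseteq> pverts (path_star_graph \<alpha>)" "inj_on f W"
  shows "\<lparr>pverts = f ` W, parcs = map_prod f f ` (parcs (path_star_graph \<alpha>) \<inter> W \<times> W)\<rparr> \<in> path_star_class \<alpha>"
proof -
  define R where "R = path_star_graph \<alpha>"
  define H where "H = \<lparr>pverts = W, parcs = parcs R \<inter> W \<times> W\<rparr>"
  define h where "h = \<lparr>iso_verts = f, iso_arcs = map_prod f f, iso_head = snd, iso_tail = fst\<rparr>"
  have "parcs R \<subseteq> pverts R \<times> pverts R"
    using assms(1) by (auto simp: R_def path_star_graph_def path_star_edges_def infinite_word_def)
  then have "pair_wf_digraph R" by unfold_locales auto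
  then have wfR: "wf_digraph (with_proj R)" by (auto simp: wf_digraph_def pair_wf_digraph_def)
  have wf: "wf_digraph (with_proj H)" by (auto simp: wf_digraph_def H_def)
  have "induced_subgraph (with_proj H) (with_proj R)"
    unfolding induced_subgraph_def subgraph_def
  proof (intro conjI wf wfR)
    show "verts (with_proj H) \<subseteq> verts (with_proj R)" using assms(3) by (simp add: H_def R_def)
    show "compatible (with_proj R) (with_proj H)" by (simp add: compatible_def)
  qed (auto simp: H_def)
  moreover have "pre_digraph.digraph_isomorphism (with_proj H) h"
    unfolding pre_digraph.digraph_isomorphism_def
  proof (intro conjI wf)
    show "inj_on (iso_verts h) (verts (with_proj H))" using assms(4) by (simp add: h_def H_def)
    show "inj_on (iso_arcs h) (arcs (with_proj H))"
      using inj_on_subset[OF map_prod_inj_on[OF assms(4,4)]] by (auto simp: h_def H_def)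
  qed (auto simp: h_def)
  then have "digraph_iso (with_proj H) (app_iso h (with_proj H))"
    by (auto simp: digraph_iso_def)
  moreover have "app_iso h (with_proj H) = with_proj \<lparr>pverts = f ` W, parcs = map_prod f f ` (parcs R \<inter> W \<times> W)\<rparr>"
    by (simp add: app_iso_def h_def H_def with_proj_def)
  ultimately show ?thesis
    using assms(2) unfolding path_star_class_def R_def[symmetric] mem_Collect_eq
    by (intro exI[of _ H]) (simp add: H_def)
qed

lemma chord_model_if_class_in_circle_graphs:
  assumes "infinite_word \<alpha>" "path_star_class \<alpha> \<subseteq> (circle_graphs :: nat pair_pre_digraph set)"
    and "finite W" "W \<subseteq> pverts (path_star_graph \<alpha>)"
  obtains c :: "ps_vertex \<Rightarrow> complex set" and z r where "r > 0" "\<And>u. u \<in> W \<Longrightarrow> c u \<in> chords z r"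
    "\<And>u v. u \<in> W \<Longrightarrow> v \<in> W \<Longrightarrow> u \<noteq> v \<Longrightarrow> c u \<inter> c v = {} \<longleftrightarrow> (u, v) \<notin> parcs (path_star_graph \<alpha>)"
proof -
  obtain f :: "ps_vertex \<Rightarrow> nat" where f: "inj_on f W"
    using finite_imp_inj_to_nat_seg[OF assms(3)] by blast
  from subsetD[OF assms(2) path_star_class_induced_copy[OF assms(1,3,4) f]]
  obtain V d z r where eq: "\<lparr>pverts = f ` W, parcs = map_prod f f ` (parcs (path_star_graph \<alpha>) \<inter> W \<times> W)\<rparr> = intersection_graph V d"
    and r: "r > 0" and d: "\<forall>v\<in>V. d v \<in> chords z r"
    unfolding circle_graphs_def by blast
  have V: "V = f ` W" and arcs: "map_prod f f ` (parcs (path_star_graph \<alpha>) \<inter> W \<times> W) =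
      {(u, v). u \<in> V \<and> v \<in> V \<and> u \<noteq> v \<and> d u \<inter> d v \<noteq> {}}"
    using eq by (simp_all add: intersection_graph_def)
  show thesis
  proof (rule that[of r "d \<circ> f" z])
    fix u v assume uv: "u \<in> W" "v \<in> W" "u \<noteq> v"
    then have "f u \<noteq> f v" using f by (auto simp: inj_on_def)
    have "(f u, f v) \<in> map_prod f f ` (parcs (path_star_graph \<alpha>) \<inter> W \<times> W) \<longleftrightarrow> (u, v) \<in> parcs (path_star_graph \<alpha>)"
    proof
      assume "(f u, f v) \<in> map_prod f f ` (parcs (path_star_graph \<alpha>) \<inter> W \<times> W)"
      then obtain a b where "f a = f u" "f b = f v" "a \<in> W" "b \<in> W" "(a, b) \<in> parcs (path_star_graph \<alpha>)"
        by auto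
      then show "(u, v) \<in> parcs (path_star_graph \<alpha>)" using uv f by (simp add: inj_on_eq_iff)
    next
      assume "(u, v) \<in> parcs (path_star_graph \<alpha>)"
      then show "(f u, f v) \<in> map_prod f f ` (parcs (path_star_graph \<alpha>) \<inter> W \<times> W)"
        using uv by (intro map_prod_imageI) simp
    qed
    then have "d (f u) \<inter> d (f v) \<noteq> {} \<longleftrightarrow> (u, v) \<in> parcs (path_star_graph \<alpha>)"
      using uv V \<open>f u \<noteq> f v\<close> unfolding arcs by simp
    then show "(d \<circ> f) u \<inter> (d \<circ> f) v = {} \<longleftrightarrow> (u, v) \<notin> parcs (path_star_graph \<alpha>)"
      by auto
  qed (use r d V in auto)
qed

text \<open>
  If the second alternance started before the end of the first, it would start with one of the
  two letters in the interior of the first.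
\<close>

lemma alternances_start_order:
  assumes "(a, b) \<in> alternances \<alpha> i j" "(a', b') \<in> alternances \<alpha> i j" "a < a'"
  shows "b \<le> a'"
  using assms unfolding alternances_def by (auto simp: not_less[symmetric])

lemma alternance_nontrivial: "(a, b) \<in> alternances \<alpha> i j \<Longrightarrow> i \<noteq> j \<Longrightarrow> a < b"
  unfolding alternances_def by (auto simp: le_less)

lemma inj_on_fst_alternances:
  assumes "i \<noteq> j"
  shows "inj_on fst (alternances \<alpha> i j)"
proof -
  have "b = b'" if "(a, b) \<in> alternances \<alpha> i j" "(a, b') \<in> alternances \<alpha> i j" for a b b'
  proof (rule ccontr)
    assume "b \<noteq> b'"
    then show False
      using that alternance_nontrivial[OF that(1) assms] alternance_nontrivial[OF that(2) assms]
      unfolding alternances_def by (cases "b < b'") auto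
  qed
  then show ?thesis by (auto simp: inj_on_def)
qed

text \<open>
  Of five alternances ordered by their starting points, take the first, third and fifth. The
  second one, which has positive length, lies between the first and the third, and the fourth one
  between the third and the fifth.
\<close>

lemma three_separate_alternances:
  assumes "i \<noteq> j" "infinite (alternances \<alpha> i j) \<or> card (alternances \<alpha> i j) > 4"
  obtains a b a' b' a'' b'' where "(a, b) \<in> alternances \<alpha> i j" "(a', b') \<in> alternances \<alpha> i j"
    "(a'', b'') \<in> alternances \<alpha> i j" "b < a'" "b' < a''"
proof -
  obtain F where F: "F \<subseteq> alternances \<alpha> i j" "card F = 5"
  proof (cases "finite (alternances \<alpha> i j)")
    case True
    then have "5 \<le> card (alternances \<alpha> i j)" using assms(2) by simp
    then show thesis using that obtain_subset_with_card_n by metis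
  next
    case False
    then show thesis using that infinite_arbitrarily_large by metis
  qed
  have "card (fst ` F) = 5"
    using F inj_on_subset[OF inj_on_fst_alternances[OF assms(1)] F(1)] by (simp add: card_image)
  define xs where "xs = sorted_list_of_set (fst ` F)"
  have fin: "finite (fst ` F)" using \<open>card (fst ` F) = 5\<close> by (intro card_ge_0_finite) simp
  have len: "length xs = 5" and sorted: "sorted_wrt (<) xs" and set: "set xs = fst ` F"
    using \<open>card (fst ` F) = 5\<close> fin by (simp_all add: xs_def)
  have less: "xs ! m < xs ! n" if "m < n" "n < 5" for m n
    using sorted_wrt_nth_less[OF sorted] that len by simp
  have "\<exists>b. (xs ! n, b) \<in> alternances \<alpha> i j" if "n < 5" for n
  proof -
    have "xs ! n \<in> fst ` F" using that len set nth_mem[of n xs] by auto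
    then show ?thesis using F(1) by force
  qed
  then obtain b where b: "\<And>n. n < 5 \<Longrightarrow> (xs ! n, b n) \<in> alternances \<alpha> i j" by metis
  show thesis
  proof (rule that[OF b[of 0] b[of 2] b[of 4]])
    show "b 0 < xs ! 2"
      using alternances_start_order[OF b[of 0] b[of 1] less] less[of 1 2] by force
    show "b 2 < xs ! 4"
      using alternances_start_order[OF b[of 2] b[of 3] less] less[of 3 4] by force
  qed auto
qed
text \<open>
  The circle can be cut open such that two given disjoint chords become intervals side by side,
  and not one inside the other. Measure angles from an endpoint of the chord of \<open>b\<close>, which is
  then \<open>{0, w}\<close>. If the chord of \<open>a\<close> lies inside \<open>[0, w]\<close>, give the origin the angle \<open>2 \<pi>\<close>
  instead of \<open>0\<close>: this turns the chord of \<open>b\<close> into \<open>{w, 2 \<pi>}\<close>.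
\<close>

lemma chord_coordinates:
  fixes c :: "'v \<Rightarrow> complex set"
  assumes "r > 0" and chords: "\<And>u. u \<in> W \<Longrightarrow> c u \<in> chords z r"
    and ab: "a \<in> W" "b \<in> W" "c a \<inter> c b = {}"
  obtains E :: "'v \<Rightarrow> real set" and s s' t t' where "s < s'" "s' < t" "t < t'"
    "\<And>u v. u \<in> W \<Longrightarrow> v \<in> W \<Longrightarrow> unlinked (E u) (E v) \<longleftrightarrow> c u \<inter> c v = {}"
    "E a = {s, s'} \<and> E b = {t, t'} \<or> E a = {t, t'} \<and> E b = {s, s'}"
proof -
  have "\<exists>f g. c u = closed_segment f g \<and> f \<in> sphere z r \<and> g \<in> sphere z r \<and> f \<noteq> g" if "u \<in> W" for u
    using chords[OF that] unfolding chords_def by blast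
  then obtain f g where fg: "c u = closed_segment (f u) (g u)" "f u \<in> sphere z r" "g u \<in> sphere z r" "f u \<noteq> g u"
    if "u \<in> W" for u
    by metis
  obtain angle :: "complex \<Rightarrow> real" where angle: "\<And>p. p \<in> sphere z r \<Longrightarrow> z + (f b - z) * cis (angle p) = p"
    and range: "\<And>p. 0 \<le> angle p" "\<And>p. angle p < 2 * pi" and origin: "angle (f b) = 0"
    using angle_coordinate[OF \<open>r > 0\<close> fg(2)[OF ab(2)]] by metis
  have "f b \<noteq> z" using fg(2)[OF ab(2)] \<open>r > 0\<close> by auto
  have model: "unlinked {h (f u), h (g u)} {h (f v), h (g v)} \<longleftrightarrow> c u \<inter> c v = {}"
    if h: "\<And>p. p \<in> sphere z r \<Longrightarrow> z + (f b - z) * cis (h p) = p" "\<And>p q. h p - h q < 2 * pi"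
      and uv: "u \<in> W" "v \<in> W" for h u v
  proof -
    note pts = h(1)[OF fg(2)[OF uv(1)]] h(1)[OF fg(3)[OF uv(1)]] h(1)[OF fg(2)[OF uv(2)]] h(1)[OF fg(3)[OF uv(2)]]
    have "h (f u) \<noteq> h (g u)" "h (f v) \<noteq> h (g v)" using pts fg(4)[OF uv(1)] fg(4)[OF uv(2)] by metis+
    from chords_disjoint_iff_unlinked[OF _ this, of "f b - z" z] show ?thesis
      using h(2) \<open>f b \<noteq> z\<close> unfolding pts fg(1)[OF uv(1)] fg(1)[OF uv(2)] by auto
  qed
  define w x y where "w = angle (g b)" and "x = min (angle (f a)) (angle (g a))"
    and "y = max (angle (f a)) (angle (g a))"
  have xy: "{x, y} = {angle (f a), angle (g a)}" by (auto simp: x_def y_def min_def max_def)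
  have "w \<noteq> 0" unfolding w_def using fg[OF ab(2)] angle origin by metis
  then have "0 < w" using range(1)[of "g b"] by (simp add: w_def)
  have "angle (f a) \<noteq> angle (g a)" using fg[OF ab(1)] angle by metis
  then have "x < y" by (auto simp: x_def y_def)
  have "0 \<le> x" using range(1) by (simp add: x_def)
  have spread: "angle p - angle q < 2 * pi" for p q using range(1)[of q] range(2)[of p] by linarith
  have "unlinked {x, y} {0, w}"
    using model[of angle a b] ab angle spread unfolding xy w_def origin by blast
  then have "w < x \<or> (0 < x \<and> y < w)"
    using \<open>x < y\<close> \<open>0 \<le> x\<close> \<open>0 < w\<close> unfolding unlinked_def by force
  then show thesis
  proof
    assume "w < x"
    show thesis
    proof (rule that[of 0 w x y "\<lambda>u. {angle (f u), angle (g u)}"])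
      show "unlinked {angle (f u), angle (g u)} {angle (f v), angle (g v)} \<longleftrightarrow> c u \<inter> c v = {}"
        if "u \<in> W" "v \<in> W" for u v
        using angle spread that by (rule model)
    qed (use \<open>w < x\<close> \<open>0 < w\<close> \<open>x < y\<close> xy origin w_def in auto)
  next
    assume less: "0 < x \<and> y < w"
    define h where "h p = (if angle p = 0 then 2 * pi else angle p)" for p
    have nonzero: "angle (f a) \<noteq> 0" "angle (g a) \<noteq> 0" using less by (auto simp: x_def)
    show thesis
    proof (rule that[of x y w "2 * pi" "\<lambda>u. {h (f u), h (g u)}"])
      show "unlinked {h (f u), h (g u)} {h (f v), h (g v)} \<longleftrightarrow> c u \<inter> c v = {}"
        if "u \<in> W" "v \<in> W" for u v
      proof (rule model[OF _ _ that])
        show "z + (f b - z) * cis (h p) = p" if "p \<in> sphere z r" for p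
          using angle[OF that] by (auto simp: h_def)
        show "h p - h q < 2 * pi" for p q
          using range(1)[of q] range(2)[of p] range(1)[of p] pi_gt_zero by (auto simp: h_def)
      qed
      show "w < 2 * pi" using range(2) by (simp add: w_def)
      show "{h (f a), h (g a)} = {x, y} \<and> {h (f b), h (g b)} = {w, 2 * pi} \<or>
          {h (f a), h (g a)} = {w, 2 * pi} \<and> {h (f b), h (g b)} = {x, y}"
        using nonzero xy origin \<open>w \<noteq> 0\<close> by (auto simp: h_def w_def)
    qed (use less \<open>x < y\<close> in auto)
  qed
qed

section \<open>Letters that alternate more than four times\<close>

theorem theorem4p3:
  fixes \<alpha> :: "nat \<Rightarrow> nat" and i j :: nat
  assumes "infinite_word \<alpha>"
    and "i \<ge> 1" and "j \<ge> 1" and "i \<noteq> j"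
    and "infinite (alternances \<alpha> i j) \<or> card (alternances \<alpha> i j) > 4"
  shows "\<not> (path_star_class \<alpha> \<subseteq> (circle_graphs :: nat pair_pre_digraph set))"
proof
  assume circle: "path_star_class \<alpha> \<subseteq> (circle_graphs :: nat pair_pre_digraph set)"
  obtain a b a' b' a'' b'' where alt: "(a, b) \<in> alternances \<alpha> i j" "(a', b') \<in> alternances \<alpha> i j"
    "(a'', b'') \<in> alternances \<alpha> i j" and sep: "b < a'" "b' < a''"
    using three_separate_alternances[OF assms(4,5)] by metis
  have "1 \<le> a" using alt(1) by (auto simp: alternances_def)
  define W where "W = Path_vertex ` {a..b''} \<union> {Star_vertex i, Star_vertex j}"
  have W: "Star_vertex i \<in> W" "Star_vertex j \<in> W" "\<And>k. a \<le> k \<Longrightarrow> k \<le> b'' \<Longrightarrow> Path_vertex k \<in> W"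
    by (auto simp: W_def)
  have "finite W" "W \<subseteq> pverts (path_star_graph \<alpha>)"
    using assms(2,3) \<open>1 \<le> a\<close> by (auto simp: W_def path_star_graph_def)
  then obtain c :: "ps_vertex \<Rightarrow> complex set" and z r where "r > 0" and chords: "\<And>u. u \<in> W \<Longrightarrow> c u \<in> chords z r"
    and c: "\<And>u v. u \<in> W \<Longrightarrow> v \<in> W \<Longrightarrow> u \<noteq> v \<Longrightarrow> c u \<inter> c v = {} \<longleftrightarrow> (u, v) \<notin> parcs (path_star_graph \<alpha>)"
    using chord_model_if_class_in_circle_graphs[OF assms(1) circle] by metis
  have "c (Star_vertex i) \<inter> c (Star_vertex j) = {}"
    using c[OF W(1,2)] assms(4) by (auto simp: path_star_graph_def path_star_edges_def)
  then obtain E :: "ps_vertex \<Rightarrow> real set" and s s' t t' where st: "s < s'" "s' < t" "t < t'"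
    and E: "\<And>u v. u \<in> W \<Longrightarrow> v \<in> W \<Longrightarrow> unlinked (E u) (E v) \<longleftrightarrow> c u \<inter> c v = {}"
    and stars: "E (Star_vertex i) = {s, s'} \<and> E (Star_vertex j) = {t, t'} \<or>
      E (Star_vertex i) = {t, t'} \<and> E (Star_vertex j) = {s, s'}"
    using chord_coordinates[where c = c and W = W, OF \<open>r > 0\<close> chords W(1,2)] by metis
  have path: "unlinked (E (Path_vertex m)) (E (Path_vertex n)) \<longleftrightarrow> n \<noteq> Suc m"
    if "a \<le> m" "m < n" "n \<le> b''" for m n
    using E[of "Path_vertex m" "Path_vertex n"] c[of "Path_vertex m" "Path_vertex n"] W(3) that \<open>1 \<le> a\<close>
    by (auto simp: path_star_graph_def path_star_edges_def)
  have star: "unlinked (E (Path_vertex k)) (E (Star_vertex l)) \<longleftrightarrow> \<alpha> k \<noteq> l"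
    if "a \<le> k" "k \<le> b''" "l = i \<or> l = j" for k l
  proof -
    have "Path_vertex k \<in> W" "Star_vertex l \<in> W" using W that by auto
    then show ?thesis
      using E[of "Path_vertex k" "Star_vertex l"] c[of "Path_vertex k" "Star_vertex l"] that(1) \<open>1 \<le> a\<close>
      by (auto simp: path_star_graph_def path_star_edges_def)
  qed
  \<comment> \<open>Either star may be the one that comes first; alternances are symmetric in the two letters.\<close>
  have contradiction: False
    if "l = i \<and> m = j \<or> l = j \<and> m = i" "E (Star_vertex l) = {s, s'}" "E (Star_vertex m) = {t, t'}" for l m
  proof -
    interpret path_with_two_stars "\<lambda>k. E (Path_vertex k)" a b'' \<alpha> l m s s' t t'
    proof
      show "unlinked (E (Path_vertex k)) {s, s'} \<longleftrightarrow> \<alpha> k \<noteq> l" if "a \<le> k" "k \<le> b''" for k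
        using star[OF that, of l] \<open>l = i \<and> m = j \<or> l = j \<and> m = i\<close> \<open>E (Star_vertex l) = {s, s'}\<close> by auto
      show "unlinked (E (Path_vertex k)) {t, t'} \<longleftrightarrow> \<alpha> k \<noteq> m" if "a \<le> k" "k \<le> b''" for k
        using star[OF that, of m] \<open>l = i \<and> m = j \<or> l = j \<and> m = i\<close> \<open>E (Star_vertex m) = {t, t'}\<close> by auto
      show "l \<noteq> m" using that(1) assms(4) by auto
    qed (use st path in auto)
    have "alternates u v" if "(u, v) \<in> alternances \<alpha> i j" for u v
      using that \<open>l = i \<and> m = j \<or> l = j \<and> m = i\<close> alternance_nontrivial[OF that assms(4)]
      unfolding alternates_def alternances_def by auto
    then show False
      using no_three_separate_alternances[OF order_refl _ sep(1) _ sep(2) _ order_refl] alt by blast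
  qed
  show False using stars contradiction[of i j] contradiction[of j i] by blast
qed

end
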